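(* Let $n\ge2$, let $\mathcal O$ be a $\varphi$-orbit of $\mathcal I_n$, and let $c$ be a snake composition that appears in $\mathcal O$. If $c$ is aperiodic, then $\#\mathcal O\equiv 1-n \pmod 4$. Furthermore, even when $c$ is periodic, $\#\mathcal O$ divides a positive integer $m$ (depending on $\mathcal O$) with $m\equiv 1-n\pmod 4$ and $m\le 3(n-1)$.
   Context: $[n]=\{1,\dots,n\}$. $\mathcal I_n$ is the set of independent sets of the path graph on $[n]$, i.e. subsets $S\subseteq[n]$ containing no two consecutive integers. For $i\in[n]$ the toggle $\tau_i:\mathcal I_n\to\mathcal I_n$ is defined by: $\tau_i(S)=S\setminus\{i\}$ if $i\in S$; $\tau_i(S)=S\cup\{i\}$ if $i\notin S$ and $S\cup\{i\}\in\mathcal I_n$; and $\tau_i(S)=S$ otherwise. $\varphi=\tau_n\cdots\tau_2\tau_1$, composed from right to left ($\tau_1$ is applied first). Orbit board: for $S\in\mathcal I_n$ and $i\in\mathbb Z$ put $S^i=\varphi^i(S)$, and set $S(i,j)=1$ if $j\in S^i$ and $S(i,j)=0$ otherwise (in particular $S(i,j)=0$ for $j<1$ or $j>n$). Snakes: whenever $S(i,j)=1$ and $j\neq n$, exactly one of $S(i,j+2)=1$ and $S(i+1,j+1)=1$ holds; similarly, whenever $S(i,j)=1$ and $j\ne1$, exactly one of $S(i,j-2)=1$ and $S(i-1,j-1)=1$ holds. Hence the ones of the orbit board are partitioned into sequences called snakes, each beginning in column $1$ and ending in column $n$, where each $1$ at $(i,j)$ with $j\ne n$ is followed by the $1$ at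 $(i,j+2)$ or at $(i+1,j+1)$. The snake composition of a snake is the sequence recording its steps in order: a step from $(i,j)$ to $(i,j+2)$ is recorded as $2$ and a step from $(i,j)$ to $(i+1,j+1)$ is recorded as $1$; it is a composition of $n-1$ with parts in $\{1,2\}$. A snake composition appears in $\mathcal O$ if it is the composition of some snake in the orbit board of an element of $\mathcal O$. A composition $c$ is periodic if it is the concatenation of $k\ge2$ copies of a single sequence, and aperiodic otherwise. *)

theory Defs
  imports "HOL-Number_Theory.Cong"
begin

definition indep_sets :: "nat \<Rightarrow> nat set set" where
  "indep_sets n = {S. S \<subseteq> {1..n} \<and> (\<forall>i\<in>S. Suc i \<notin> S)}"

definition toggle :: "nat \<Rightarrow> nat \<Rightarrow> nat set \<Rightarrow> nat set" where
  "toggle n i S =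
    (if i \<in> S then S - {i}
     else if S \<union> {i} \<in> indep_sets n then S \<union> {i}
     else S)"

text \<open>\<^const>\<open>fold\<close> processes its list from the left, so the toggle at \<open>1\<close> is applied first.\<close>

definition phi :: "nat \<Rightarrow> nat set \<Rightarrow> nat set" where
  "phi n S = fold (toggle n) [1..<Suc n] S"

lemma toggle_in_indep_sets:
  assumes "S \<in> indep_sets n"
  shows "toggle n i S \<in> indep_sets n"
  using assms by (auto simp: toggle_def indep_sets_def)

lemma toggle_toggle:
  assumes "S \<in> indep_sets n"
  shows "toggle n i (toggle n i S) = S"
  using assms by (auto simp: toggle_def insert_absorb)

lemma bij_betw_toggle: "bij_betw (toggle n i) (indep_sets n) (indep_sets n)"
  by (rule bij_betw_byWitness[where f' = "toggle n i"])
    (auto simp: toggle_toggle toggle_in_indep_sets)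

lemma bij_betw_fold_toggle: "bij_betw (fold (toggle n) is) (indep_sets n) (indep_sets n)"
proof (induction "is")
  case Nil
  show ?case by (simp add: bij_betw_def)
next
  case (Cons i "is")
  show ?case
    using bij_betw_trans[OF bij_betw_toggle Cons.IH] by (simp add: comp_def)
qed

lemma bij_betw_phi: "bij_betw (phi n) (indep_sets n) (indep_sets n)"
  using bij_betw_fold_toggle by (simp add: phi_def[abs_def] del: upt_Suc)

text \<open>
  Integer powers of \<^const>\<open>phi\<close>. It is only as a self-map of \<^term>\<open>indep_sets n\<close> that
  \<^const>\<open>phi\<close> is invertible, so the inverse is taken relative to that set.
\<close>

definition phi_power :: "nat \<Rightarrow> int \<Rightarrow> nat set \<Rightarrow> nat set" where
  "phi_power n i S =
    (if i \<ge> 0 then (phi n ^^ nat i) S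
     else (inv_into (indep_sets n) (phi n) ^^ nat (- i)) S)"

definition phi_orbit :: "nat \<Rightarrow> nat set \<Rightarrow> nat set set" where
  "phi_orbit n S = range (\<lambda>i. phi_power n i S)"

definition phi_orbits :: "nat \<Rightarrow> nat set set set" where
  "phi_orbits n = phi_orbit n ` indep_sets n"

definition board :: "nat \<Rightarrow> nat set \<Rightarrow> int \<Rightarrow> nat \<Rightarrow> nat" where
  "board n S i j = (if j \<in> phi_power n i S then 1 else 0)"

text \<open>
  A snake is given by its list of positions (row, column), from column \<open>1\<close> to column \<open>n\<close>.
  Since every one outside column \<open>n\<close> has exactly one admissible successor, and every one
  outside column \<open>1\<close> exactly one admissible predecessor, these lists partition the ones of
  the board.
\<close>

definition is_snake :: "nat \<Rightarrow> nat set \<Rightarrow> (int \<times> nat) list \<Rightarrow> bool" where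
  "is_snake n S ps \<longleftrightarrow>
     ps \<noteq> [] \<and> snd (hd ps) = 1 \<and> snd (last ps) = n \<and>
     (\<forall>(i, j)\<in>set ps. board n S i j = 1) \<and>
     successively (\<lambda>(i, j) q. q = (i, j + 2) \<or> q = (i + 1, j + 1)) ps"

definition snake_composition :: "(int \<times> nat) list \<Rightarrow> nat list" where
  "snake_composition ps = map2 (\<lambda>(i, j) q. if q = (i, j + 2) then 2 else 1) ps (tl ps)"

definition appears_in :: "nat \<Rightarrow> nat list \<Rightarrow> nat set set \<Rightarrow> bool" where
  "appears_in n c \<O> \<longleftrightarrow> (\<exists>S\<in>\<O>. \<exists>ps. is_snake n S ps \<and> c = snake_composition ps)"

definition periodic :: "'a list \<Rightarrow> bool" where
  "periodic c \<longleftrightarrow> (\<exists>k\<ge>2. \<exists>d. c = concat (replicate k d))"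

end

theory Submission
  imports Defs
begin

text \<open>
  If a snake starting in row \<open>r\<close> has composition \<open>(c\<^sub>1, \<dots>, c\<^sub>L)\<close>, then the next snake
  starts in row \<open>r + 4 - c\<^sub>1\<close> and has the rotated composition \<open>(c\<^sub>2, \<dots>, c\<^sub>L, c\<^sub>1)\<close>:
  it is the old snake without its first position, translated by \<open>(2, -c\<^sub>1)\<close>, and continued
  by a step \<open>c\<^sub>1\<close>. After \<open>L\<close> snakes the composition recurs, \<open>m = 4 L - (n - 1)\<close> rows
  further down; as every \<open>1\<close> of the board lies on a snake, the board has period \<open>m\<close>. If the composition is
  aperiodic, it cannot recur earlier, so \<open>m\<close> is the exact period.
\<close>

section \<open>Periods of maps on the integers, and words fixed by a rotation\<close>

text \<open>For \<open>f\<close> sending a row index to its set, the range is the orbit and its size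
  the exact period. A least positive return time \<open>p\<close> exists because \<open>f\<close>
  cannot be injective; the values at \<open>0, ..., p - 1\<close> list the range without
  repetition.\<close>

lemma range_period:
  fixes f :: "int \<Rightarrow> 'a"
  assumes shift: "\<And>a b x. f a = f b \<Longrightarrow> f (a + x) = f (b + x)"
    and fin: "finite (range f)"
  shows "card (range f) > 0"
    and "f a = f b \<longleftrightarrow> int (card (range f)) dvd a - b"
proof -
  have "\<not> inj f" using fin finite_imageD infinite_UNIV_int by blast
  then obtain x y where "x < y" and "f x = f y" unfolding inj_def by (metis linorder_neqE)
  then have "f 0 = f (int (nat (y - x)))" and "nat (y - x) > 0"
    using shift[of x y "- x"] by simp_all
  then have ex: "\<exists>d>0. f 0 = f (int d)" by blast
  define p where "p = (LEAST d. d > 0 \<and> f 0 = f (int d))"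
  have p: "p > 0" "f 0 = f (int p)" unfolding p_def using LeastI_ex[OF ex] by auto
  have least: "p \<le> d" if "d > 0" "f 0 = f (int d)" for d
    unfolding p_def using that by (simp add: Least_le)
  have add_p: "f (x + int p) = f x" for x
    using shift[OF p(2), of x] by (simp add: add.commute)
  have add_mult: "f (x + int p * int k) = f x" for x k
  proof (induction k)
    case (Suc k)
    then show ?case using add_p[of "x + int p * int k"] by (simp add: algebra_simps)
  qed simp
  have add_mult_int: "f (x + int p * k) = f x" for x k
  proof (cases "k \<ge> 0")
    case True
    then show ?thesis using add_mult[of x "nat k"] by simp
  next
    case False
    then show ?thesis using add_mult[of "x + int p * k" "nat (- k)"] by simp
  qed
  have f_mod: "f x = f (x mod int p)" for x
    using add_mult_int[of "x mod int p" "x div int p"] by simp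
  have small: "x = y" if "f x = f y" "0 \<le> x" "x \<le> y" "y < int p" for x y
  proof (rule ccontr)
    assume "x \<noteq> y"
    have "f 0 = f (int (nat (y - x)))" using shift[OF that(1), of "- x"] that by simp
    with least[of "nat (y - x)"] \<open>x \<noteq> y\<close> that show False by simp
  qed
  have inj: "inj_on f {0..<int p}"
    by (rule inj_onI) (metis atLeastLessThan_iff linear small)
  have "f x \<in> f ` {0..<int p}" for x
    by (subst f_mod[of x]) (use p(1) in auto)
  then have "range f = f ` {0..<int p}" by blast
  then have card: "card (range f) = p" using inj by (simp add: card_image)
  show "card (range f) > 0" using card p by simp
  have "f a = f b \<longleftrightarrow> f (a mod int p) = f (b mod int p)" using f_mod by metis
  also have "\<dots> \<longleftrightarrow> a mod int p = b mod int p"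
    using inj p(1) by (auto simp: inj_on_def)
  finally show "f a = f b \<longleftrightarrow> int (card (range f)) dvd a - b"
    using card by (simp add: mod_eq_dvd_iff)
qed

text \<open>Cutting \<open>c\<close> at \<open>k mod length c\<close> gives two nonempty words that
  commute under concatenation, and commuting words are powers of a common word.\<close>

lemma rotate_eq_self_imp_periodic:
  assumes "c \<noteq> []" "rotate k c = c" "\<not> length c dvd k"
  shows "periodic c"
proof -
  define t where "t = k mod length c"
  have t: "0 < t" "t < length c"
    using assms by (auto simp: t_def dvd_eq_mod_eq_0)
  have "drop t c @ take t c = take t c @ drop t c"
    using assms(2) by (simp add: rotate_drop_take t_def)
  then obtain a b d where ab: "concat (replicate a d) = drop t c" "concat (replicate b d) = take t c"
    using comm_append_are_replicate by metis
  have "drop t c \<noteq> []" "take t c \<noteq> []" using t by auto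
  then have "a \<noteq> 0" "b \<noteq> 0" using ab by (metis concat.simps(1) replicate_0)+
  then have "b + a \<ge> 2" by linarith
  moreover have "c = concat (replicate (b + a) d)"
    unfolding replicate_add concat_append ab by simp
  ultimately show ?thesis unfolding periodic_def by (intro exI conjI)
qed

text \<open>The row distance from the start of a snake with composition \<open>c\<close> to the
  start of the \<open>k\<close>-th snake after it. \<open>hd (rotate t c)\<close> reads
  \<open>c\<close> cyclically, so \<open>k\<close> may exceed its length.\<close>

definition snake_offset :: "nat list \<Rightarrow> nat \<Rightarrow> int" where
  "snake_offset c k = (\<Sum>t<k. 4 - int (hd (rotate t c)))"

lemma snake_offset_Suc: "snake_offset c (Suc k) = snake_offset c k + (4 - int (hd (rotate k c)))"
  by (simp add: snake_offset_def)

lemma snake_offset_length: "snake_offset c (length c) = 4 * int (length c) - int (sum_list c)"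
proof -
  have "snake_offset c (length c) = (\<Sum>t<length c. 4 - int (c ! t))"
    unfolding snake_offset_def
  proof (rule sum.cong)
    fix t assume "t \<in> {..<length c}"
    then have "c \<noteq> []" "t < length c" by auto
    then show "4 - int (hd (rotate t c)) = 4 - int (c ! t)" by (simp add: hd_rotate_conv_nth)
  qed simp
  then show ?thesis
    by (simp add: sum_subtractf sum_list_sum_nth atLeast0LessThan)
qed

lemma snake_offset_mult: "snake_offset c (q * length c) = int q * snake_offset c (length c)"
proof (induction q)
  case (Suc q)
  have "rotate (q * length c + t) c = rotate t c" for t
    by (subst (1 2) rotate_conv_mod) simp
  then have "snake_offset c (q * length c + x) = snake_offset c (q * length c) + snake_offset c x" for x
    by (induction x) (simp_all add: snake_offset_def)
  from this[of "length c"] Suc show ?case by (simp add: algebra_simps)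
qed (simp add: snake_offset_def)

section \<open>Boards governed by the local toggle rule\<close>

text \<open>When column \<open>Suc j\<close> of row \<open>r + 1\<close> is decided, the column to
  its left is already updated, while the column to its right still has its value from row
  \<open>r\<close>.\<close>

locale orbit_board =
  fixes n :: nat and B :: "int \<Rightarrow> nat \<Rightarrow> bool"
  assumes width: "n \<ge> 2"
    and column_0: "\<not> B r 0"
    and rule: "B (r + 1) (Suc j) \<longleftrightarrow>
      Suc j \<le> n \<and> \<not> B r (Suc j) \<and> \<not> B (r + 1) j \<and> \<not> B r (Suc (Suc j))"
begin

lemma rule': "B r (Suc j) \<longleftrightarrow>
    Suc j \<le> n \<and> \<not> B (r - 1) (Suc j) \<and> \<not> B r j \<and> \<not> B (r - 1) (Suc (Suc j))"
  using rule[of "r - 1"] by simp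

lemma col_le: "B r j \<Longrightarrow> j \<le> n"
  using rule'[of r "j - 1"] by (cases j) auto

text \<open>Each exclusion is one conjunct of \<open>rule\<close>, read at the given cell or at the
  excluded one. Only the two diagonal cells along which snakes run stay possible.\<close>

lemma neighbours:
  assumes "B r j"
  shows "\<not> B (r + 1) j" "\<not> B (r - 1) j" "\<not> B r (Suc j)" "\<not> B (r - 1) (Suc j)"
    "j = Suc k \<Longrightarrow> \<not> B r k" "j = Suc k \<Longrightarrow> \<not> B (r + 1) k"
proof -
  obtain i where "j = Suc i" using assms column_0 by (cases j) auto
  then show "\<not> B (r + 1) j" "\<not> B (r - 1) j" "\<not> B r (Suc j)" "\<not> B (r - 1) (Suc j)"
    "j = Suc k \<Longrightarrow> \<not> B r k" "j = Suc k \<Longrightarrow> \<not> B (r + 1) k"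
    using assms rule[of r i] rule'[of r i] rule'[of r j] column_0 rule'[of "r + 1" "k - 1"]
    by (cases k; auto)+
qed

lemma successor:
  assumes "B r j" "j < n"
  shows "B r (j + 2) \<noteq> B (r + 1) (j + 1)"
  using assms neighbours[OF assms(1)] rule[of r j] by auto

text \<open>If both candidates were zero, the rule would put a one at \<open>(r, j + 1)\<close>,
  next to \<open>(r, j + 2)\<close>.\<close>

lemma predecessor:
  assumes "B r (Suc (Suc j))"
  shows "B r j \<or> B (r - 1) (Suc j)"
  using assms neighbours[OF assms] rule'[of r j] col_le[OF assms] by auto

section \<open>Snakes and their tails, encoded by their steps\<close>

primrec snake_from :: "int \<Rightarrow> nat \<Rightarrow> nat list \<Rightarrow> bool" where
  "snake_from r j [] \<longleftrightarrow> B r j \<and> j = n"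
| "snake_from r j (s # cs) \<longleftrightarrow> B r j \<and>
    (s = 2 \<and> snake_from r (j + 2) cs \<or> s = 1 \<and> snake_from (r + 1) (j + 1) cs)"

lemma snake_from_start: "snake_from r j cs \<Longrightarrow> B r j"
  by (cases cs) auto

lemma snake_from_sum: "snake_from r j cs \<Longrightarrow> j + sum_list cs = n"
  by (induction cs arbitrary: r j) fastforce+

text \<open>For a full snake the sum is \<open>n - 1\<close>; these bounds then make
  \<open>4 * length c - (n - 1)\<close> positive and at most \<open>3 * (n - 1)\<close>.\<close>

lemma snake_from_length:
  "snake_from r j cs \<Longrightarrow> length cs \<le> sum_list cs \<and> sum_list cs \<le> 2 * length cs"
  by (induction cs arbitrary: r j) fastforce+

text \<open>A step \<open>s\<close> advances \<open>s\<close> columns and \<open>2 - s\<close>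
  rows.\<close>

lemma snake_from_append:
  "snake_from r j (ds @ cs) \<Longrightarrow>
    snake_from (r + 2 * int (length ds) - int (sum_list ds)) (j + sum_list ds) cs"
proof (induction ds arbitrary: r j)
  case (Cons d ds)
  then show ?case using Cons.IH[of r "j + 2"] Cons.IH[of "r + 1" "j + 1"]
    by (auto simp: algebra_simps)
qed simp

lemma snake_from_exists:
  assumes "B r j" shows "\<exists>cs. snake_from r j cs"
  using assms
proof (induction "n - j" arbitrary: r j rule: less_induct)
  case less
  show ?case
  proof (cases "j = n")
    case True
    then show ?thesis using less.prems by (intro exI[of _ "[]"]) simp
  next
    case False
    with col_le[OF less.prems] have "j < n" by simp
    with successor[OF less.prems] consider "B r (j + 2)" | "B (r + 1) (j + 1)" by blast
    then show ?thesis
    proof cases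
      case 1
      moreover have "n - (j + 2) < n - j" using \<open>j < n\<close> by simp
      ultimately obtain cs where "snake_from r (j + 2) cs" using less.hyps by blast
      with less.prems show ?thesis by (intro exI[of _ "2 # cs"]) simp
    next
      case 2
      moreover have "n - (j + 1) < n - j" using \<open>j < n\<close> by simp
      ultimately obtain cs where "snake_from (r + 1) (j + 1) cs" using less.hyps by blast
      with less.prems show ?thesis by (intro exI[of _ "1 # cs"]) simp
    qed
  qed
qed

lemma snake_from_unique: "snake_from r j cs \<Longrightarrow> snake_from r j ds \<Longrightarrow> cs = ds"
proof (induction cs arbitrary: r j ds)
  case Nil
  then show ?case using snake_from_sum[of r j ds]
    by (cases ds) auto
next
  case (Cons s cs)
  note start = snake_from_start[OF Cons.prems(1)]
  have "j < n" using snake_from_sum[OF Cons.prems(1)] Cons.prems(1) by auto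
  then obtain d ds' where "ds = d # ds'" using Cons.prems(2) by (cases ds) auto
  with Cons successor[OF start \<open>j < n\<close>] show ?case
    by (auto dest: snake_from_start)
qed

section \<open>The next snake, and the chain of all snakes\<close>

text \<open>The tail \<open>cs\<close> is copied step by step, two rows down and \<open>s\<close>
  columns to the left. Ones of the old tail and the cell copied last exclude every one that could
  block the next copied cell.\<close>

lemma snake_from_shift:
  assumes "s = 1 \<or> s = 2" "snake_from a (b + s) cs" "B (a + 2) b"
  shows "snake_from (a + 2) b (cs @ [s])"
  using assms(2,3)
proof (induction cs arbitrary: a b)
  case Nil
  then have b: "b + s = n" "B a (b + s)" by auto
  \<comment> \<open>The copy has reached column \<open>n - s\<close>. Emptiness of column
    \<open>n + 1\<close> removes the last possible blocker of the final step
    \<open>s\<close>.\<close>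
  have out: "\<not> B r (Suc n)" for r using col_le[of r "Suc n"] by auto
  note nb = neighbours[OF b(2)] neighbours[OF Nil(2)]
  from assms(1) show ?case
  proof
    assume s: "s = 1"
    then have "B (a + 2 + 1) (b + 1)"
      using b out[of "a + 2"] nb rule[of "a + 2" b] by auto
    with s b Nil(2) show ?thesis by auto
  next
    assume s: "s = 2"
    then have "B (a + 2) (b + 2)"
      using b out[of "a + 1"] nb rule'[of "a + 2" "b + 1"] by (auto simp: add.commute)
    with s b Nil(2) show ?thesis by auto
  qed
next
  case (Cons t cs)
  note ab = snake_from_start[OF Cons.prems(1)]
  note nb = neighbours[OF ab] neighbours[OF Cons.prems(2)]
  consider (two) "t = 2" "snake_from a (b + 2 + s) cs" | (one) "t = 1" "snake_from (a + 1) (b + 1 + s) cs"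
    using Cons.prems(1) by (auto simp: ac_simps)
  then show ?case
  proof cases
    case two
    note start = snake_from_start[OF two(2)]
    have "b + 2 \<le> n" using col_le[OF start] by simp
    \<comment> \<open>Possible blockers are \<open>(a + 1, b + 2)\<close> and
      \<open>(a + 1, b + 3)\<close>, excluded by the old ones in columns \<open>b + s\<close> and
      \<open>b + 2 + s\<close>, and \<open>(a + 2, b + 1)\<close>, excluded by the copied
      cell.\<close>
    then have "B (a + 2) (b + 2)"
      using nb neighbours[OF start] rule[of "a + 1" "b + 1"] assms(1)
        neighbours(5)[OF ab] neighbours(6)[OF start]
      by (auto simp: numeral_2_eq_2 add.assoc)
    with Cons.IH[OF two(2)] two(1) Cons.prems(2) show ?thesis by simp
  next
    case one
    note start = snake_from_start[OF one(2)]
    have "b + 1 \<le> n" using col_le[OF start] by simp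
    then have "B (a + 1 + 2) (b + 1)"
      using nb neighbours[OF start] rule[of "a + 2" "b"] assms(1) rule[of "a + 1" "b + 1"]
      by (auto simp: numeral_2_eq_2 add.assoc)
    with Cons.IH[OF one(2)] one(1) Cons.prems(2) show ?thesis by (simp add: add.commute add.left_commute)
  qed
qed

text \<open>The new start lies two rows below the second position of the old snake, as
  \<open>snake_from_shift\<close> requires: the first two positions exclude all its
  blockers.\<close>

lemma next_snake:
  assumes "snake_from r 1 (s # cs)"
  shows "snake_from (r + (4 - int s)) 1 (cs @ [s])"
proof -
  have r1: "B r 1" using assms by simp
  consider (two) "s = 2" "snake_from r 3 cs" | (one) "s = 1" "snake_from (r + 1) 2 cs"
    using assms by (auto simp: eval_nat_numeral)
  then show ?thesis
  proof cases
    case two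
    note start = snake_from_start[OF two(2)]
    have "B (r + 2) 1"
      using neighbours[OF r1] neighbours(6)[OF start, of 2] rule'[of "r + 2" 0] column_0 width
      by (simp add: eval_nat_numeral add.commute)
    then show ?thesis using snake_from_shift[of s r 1 cs] two by (simp add: eval_nat_numeral)
  next
    case one
    note start = snake_from_start[OF one(2)]
    have "B (r + 3) 1"
      using neighbours(1)[OF start] neighbours(6)[OF start, of 1] rule'[of "r + 3" 0] column_0 width
      by (simp add: eval_nat_numeral)
    then show ?thesis using snake_from_shift[of s "r + 1" 1 cs] one
      by (simp add: add.commute numeral_2_eq_2)
  qed
qed

lemma snake_from_rotate:
  assumes "snake_from r 1 c"
  shows "snake_from (r + snake_offset c k) 1 (rotate k c)"
proof (induction k)
  case 0
  then show ?case using assms by (simp add: snake_offset_def)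
next
  case (Suc k)
  have "rotate k c \<noteq> []" using assms width by auto
  then obtain s cs where s: "rotate k c = s # cs" by (cases "rotate k c") auto
  have "snake_from (r + snake_offset c k + (4 - int s)) 1 (cs @ [s])"
    by (rule next_snake) (use Suc s in simp)
  with s show ?case by (simp add: snake_offset_Suc add.assoc)
qed

lemma snake_from_recurs:
  assumes "snake_from r 1 c"
  shows "snake_from (r + (4 * int (length c) - (int n - 1))) 1 c"
proof -
  have "int n - 1 = int (sum_list c)" using snake_from_sum[OF assms] by linarith
  then show ?thesis
    using snake_from_rotate[OF assms, of "length c"] by (simp add: snake_offset_length)
qed

text \<open>Column \<open>1\<close> is zero in row \<open>r - 1\<close>, so a one in row
  \<open>r - 2\<close> blocked it: either in column \<open>1\<close>, or in column \<open>2\<close>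
  with predecessor \<open>(r - 3, 1)\<close>.\<close>

lemma previous_start:
  assumes "B r 1" shows "B (r - 2) 1 \<or> B (r - 3) 1"
proof -
  have "\<not> B (r - 1) 1" "\<not> B (r - 1) 2"
    using neighbours[OF assms] by (auto simp: numeral_2_eq_2)
  then have "B (r - 2) 1 \<or> B (r - 2) 2"
    using rule'[of "r - 1" 0] column_0 width by (simp add: numeral_2_eq_2)
  then show ?thesis using predecessor[of "r - 2" 0] column_0 by (auto simp: numeral_2_eq_2)
qed

text \<open>By induction the previous start belongs to the chain of rotated snakes, and the next
  member of the chain must then begin exactly here.\<close>

lemma all_starts:
  assumes "snake_from r 1 c" "B (r + int x) 1"
  shows "\<exists>k. snake_from (r + int x) 1 (rotate k c) \<and> int x = snake_offset c k"
  using assms(2)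
proof (induction x rule: less_induct)
  case (less x)
  have r1: "B r 1" using assms(1) snake_from_start by blast
  have step: ?case if y: "B (r + int y) 1" "y < x" "x \<le> y + 3" "y + 2 \<le> x" for y
  proof -
    obtain k where k: "snake_from (r + int y) 1 (rotate k c)" "int y = snake_offset c k"
      using less.IH[OF y(2,1)] by blast
    have "rotate k c \<noteq> []" using assms(1) width by auto
    then obtain s cs where s: "rotate k c = s # cs" by (cases "rotate k c") auto
    have s12: "s = 1 \<or> s = 2" using k s by auto
    have snake: "snake_from (r + int y + (4 - int s)) 1 (cs @ [s])"
      using next_snake k s by simp
    note start = snake_from_start[OF snake]
    \<comment> \<open>Both sides lie in \<open>{y + 2, y + 3}\<close>; if they differed, column
      \<open>1\<close> would have ones in adjacent rows.\<close>
    have "x = y + 4 - s"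
      using neighbours(1,2)[OF less.prems] start s12 y(3,4)
      by (elim disjE; cases "x = y + 2"; cases "x = y + 3") (auto simp: algebra_simps)
    then have x: "int x = int y + (4 - int s)" using s12 by auto
    moreover have "r + int x = r + int y + (4 - int s)" using x by simp
    ultimately show ?thesis using snake k(2) s
      by (intro exI[of _ "Suc k"]) (simp add: snake_offset_Suc add.assoc)
  qed
  show ?case
  proof (cases "x = 0")
    case True
    then show ?thesis using assms(1) by (intro exI[of _ 0]) (simp add: snake_offset_def)
  next
    case False
    have "x \<noteq> 1" using neighbours(1)[OF r1] less.prems by auto
    with False have x2: "x \<ge> 2" by simp
    from previous_start[OF less.prems] show ?thesis
    proof
      assume "B (r + int x - 2) 1"
      then show ?thesis using step[of "x - 2"] x2 by (simp add: of_nat_diff add_diff_eq)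
    next
      assume a: "B (r + int x - 3) 1"
      \<comment> \<open>Otherwise the previous start would be in row \<open>r - 1\<close>, adjacent
        to the start in row \<open>r\<close>. So \<open>x - 3\<close> is not truncated.\<close>
      have "x \<noteq> 2" using a neighbours(2)[OF r1] by auto
      with a x2 show ?thesis using step[of "x - 3"] by (simp add: of_nat_diff add_diff_eq)
    qed
  qed
qed

text \<open>Predecessors lead back to column \<open>1\<close>, going up at most one row per step.
  The bound on \<open>r\<close> serves \<open>recurrence\<close>, since \<open>all_starts\<close>
  only looks downwards.\<close>

lemma snake_from_extend_left:
  assumes "snake_from a b cs"
  shows "\<exists>r ds. snake_from r 1 (ds @ cs) \<and> a - int b \<le> r \<and>
    1 + sum_list ds = b \<and> r + 2 * int (length ds) - int (sum_list ds) = a"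
  using assms
proof (induction b arbitrary: a cs rule: less_induct)
  case (less b)
  note start = snake_from_start[OF less.prems]
  consider "b = 1" | j where "b = Suc (Suc j)"
    using start column_0 by (metis One_nat_def not0_implies_Suc)
  then show ?case
  proof cases
    case 1
    then show ?thesis using less.prems by (intro exI[of _ a] exI[of _ "[]"]) simp
  next
    case (2 j)
    with start predecessor consider "B a j" | "B (a - 1) (Suc j)" by blast
    then show ?thesis
    proof cases
      case 1
      then have "snake_from a j (2 # cs)" using less.prems 2 by simp
      from less.IH[OF _ this] 2 obtain r ds where "snake_from r 1 (ds @ 2 # cs)"
        "a - int j \<le> r" "1 + sum_list ds = j" "r + 2 * int (length ds) - int (sum_list ds) = a" by auto
      then show ?thesis using 2 by (intro exI[of _ r] exI[of _ "ds @ [2]"]) auto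
    next
      case b: 2
      then have "snake_from (a - 1) (Suc j) (1 # cs)" using less.prems 2 by simp
      from less.IH[OF _ this] 2 obtain r ds where "snake_from r 1 (ds @ 1 # cs)"
        "a - 1 - int (Suc j) \<le> r" "1 + sum_list ds = Suc j"
        "r + 2 * int (length ds) - int (sum_list ds) = a - 1" by auto
      then show ?thesis using 2 by (intro exI[of _ r] exI[of _ "ds @ [1]"]) auto
    qed
  qed
qed

text \<open>The snake through \<open>(a, j)\<close> has a rotation of \<open>c\<close> as
  composition, hence the same number of parts, and so recurs after the same number of rows with a
  one in the same relative position.\<close>

lemma recurrence:
  assumes c: "snake_from r 1 c" and a: "r + int n \<le> a" and B: "B a j"
  shows "B (a + (4 * int (length c) - (int n - 1))) j"
proof -
  obtain cs where "snake_from a j cs" using snake_from_exists[OF B] by blast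
  from snake_from_extend_left[OF this] obtain u ds where u: "snake_from u 1 (ds @ cs)" "a - int j \<le> u"
    "1 + sum_list ds = j" "u + 2 * int (length ds) - int (sum_list ds) = a" by blast
  \<comment> \<open>The margin of \<open>n\<close> rows makes this snake start no earlier than row
    \<open>r\<close>.\<close>
  have "r \<le> u" using u(2) a col_le[OF B] by simp
  then obtain k where "snake_from u 1 (rotate k c)"
    using all_starts[OF c, of "nat (u - r)"] snake_from_start[OF u(1)] by auto
  from snake_from_unique[OF this u(1)] have len: "length (ds @ cs) = length c"
    by (metis length_rotate)
  let ?m = "4 * int (length c) - (int n - 1)"
  have "u + ?m + 2 * int (length ds) - int (sum_list ds) = a + ?m" using u(4) by linarith
  with snake_from_append[OF snake_from_recurs[OF u(1)]] u(3)
  have "snake_from (a + ?m) j cs" unfolding len by metis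
  then show ?thesis by (rule snake_from_start)
qed

end

section \<open>From toggles to the local rule\<close>

lemma finite_indep_sets: "finite (indep_sets n)"
  by (rule finite_subset[of _ "Pow {1..n}"]) (auto simp: indep_sets_def)

lemma phi_in_indep_sets: "S \<in> indep_sets n \<Longrightarrow> phi n S \<in> indep_sets n"
  by (rule bij_betw_apply[OF bij_betw_phi])

lemma fold_toggle_in_indep_sets:
  "S \<in> indep_sets n \<Longrightarrow> fold (toggle n) is S \<in> indep_sets n"
  by (rule bij_betw_apply[OF bij_betw_fold_toggle])

lemma toggle_mem_other: "j \<noteq> i \<Longrightarrow> j \<in> toggle n i S \<longleftrightarrow> j \<in> S"
  by (auto simp: toggle_def)

lemma fold_toggle_mem_later:
  "k < j \<Longrightarrow> j \<in> fold (toggle n) [1..<Suc k] S \<longleftrightarrow> j \<in> S"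
  by (induction k) (simp_all add: toggle_mem_other)

lemma fold_toggle_mem_earlier:
  "j \<le> k \<Longrightarrow> j \<in> fold (toggle n) [1..<Suc k] S \<longleftrightarrow> j \<in> fold (toggle n) [1..<Suc j] S"
proof (induction k rule: dec_induct)
  case (step k)
  then show ?case using toggle_mem_other[of j "Suc k"] by simp
qed simp

text \<open>The sweep is cut just before the toggle at \<open>Suc j\<close>: in the intermediate set
  \<open>T\<close>, column \<open>j\<close> is final and all columns beyond \<open>j\<close> are as
  in \<open>S\<close>.\<close>

lemma mem_phi_iff:
  assumes S: "S \<in> indep_sets n"
  shows "Suc j \<in> phi n S \<longleftrightarrow> Suc j \<le> n \<and> Suc j \<notin> S \<and> j \<notin> phi n S \<and> Suc (Suc j) \<notin> S"
proof (cases "Suc j \<le> n")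
  case True
  define T where "T = fold (toggle n) [1..<Suc j] S"
  have T: "T \<in> indep_sets n" unfolding T_def using S by (rule fold_toggle_in_indep_sets)
  have T_later: "i \<in> T \<longleftrightarrow> i \<in> S" if "j < i" for i
    unfolding T_def using that by (rule fold_toggle_mem_later)
  have "j \<in> phi n S \<longleftrightarrow> j \<in> T"
    unfolding phi_def T_def using True by (intro fold_toggle_mem_earlier) simp
  moreover have "Suc j \<in> phi n S \<longleftrightarrow> Suc j \<in> toggle n (Suc j) T"
    unfolding phi_def T_def using fold_toggle_mem_earlier[OF True] by simp
  moreover have "Suc j \<in> toggle n (Suc j) T \<longleftrightarrow> Suc j \<notin> T \<and> j \<notin> T \<and> Suc (Suc j) \<notin> T"
    using T True by (auto simp: toggle_def indep_sets_def)
  ultimately show ?thesis using True T_later by auto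
next
  case False
  then show ?thesis using phi_in_indep_sets[OF S] by (auto simp: indep_sets_def)
qed

section \<open>Integer powers and orbits\<close>

lemma phi_power_in_indep_sets:
  assumes "S \<in> indep_sets n"
  shows "phi_power n i S \<in> indep_sets n"
proof -
  have "(phi n ^^ k) S \<in> indep_sets n" for k
    by (induction k) (simp_all add: assms phi_in_indep_sets)
  moreover have "(inv_into (indep_sets n) (phi n) ^^ k) S \<in> indep_sets n" for k
    by (induction k) (simp_all add: assms bij_betw_apply[OF bij_betw_inv_into[OF bij_betw_phi]])
  ultimately show ?thesis by (simp add: phi_power_def)
qed

lemma phi_power_plus_1:
  assumes "S \<in> indep_sets n"
  shows "phi_power n (i + 1) S = phi n (phi_power n i S)"
proof (cases "i \<ge> 0")
  case True
  then show ?thesis by (simp add: phi_power_def nat_add_distrib)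
next
  case False
  then have eq: "nat (- i) = Suc (nat (- (i + 1)))" by simp
  have "phi_power n i S = inv_into (indep_sets n) (phi n) (phi_power n (i + 1) S)"
    using False eq by (auto simp: phi_power_def)
  then show ?thesis
    using bij_betw_inv_into_right[OF bij_betw_phi phi_power_in_indep_sets[OF assms]] by simp
qed

text \<open>Equality propagates forwards by applying \<open>phi\<close> and backwards by its
  injectivity on \<open>indep_sets n\<close>. Two base points serve both the period and the change
  of base point in an orbit.\<close>

lemma phi_power_shift:
  assumes "S \<in> indep_sets n" "T \<in> indep_sets n" "phi_power n a S = phi_power n b T"
  shows "phi_power n (a + x) S = phi_power n (b + x) T"
proof (induction x rule: int_induct[of _ 0])
  case base
  then show ?case using assms by simp
next
  case (step1 x)
  then show ?case using phi_power_plus_1[OF assms(1), of "a + x"]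
    phi_power_plus_1[OF assms(2), of "b + x"] by (simp add: add.assoc)
next
  case (step2 x)
  have "phi n (phi_power n (a + (x - 1)) S) = phi n (phi_power n (b + (x - 1)) T)"
    using step2 phi_power_plus_1[OF assms(1), of "a + (x - 1)"]
      phi_power_plus_1[OF assms(2), of "b + (x - 1)"] by simp
  then show ?case
    using bij_betw_imp_inj_on[OF bij_betw_phi] phi_power_in_indep_sets assms(1,2)
    by (metis inj_onD)
qed

lemma phi_orbit_eq:
  assumes "S \<in> indep_sets n" "T \<in> phi_orbit n S"
  shows "T \<in> indep_sets n" "phi_orbit n T = phi_orbit n S"
proof -
  obtain b where b: "T = phi_power n b S" using assms(2) by (auto simp: phi_orbit_def)
  then show T: "T \<in> indep_sets n" using phi_power_in_indep_sets assms(1) by simp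
  have shift: "phi_power n x T = phi_power n (b + x) S" for x
    using phi_power_shift[OF T assms(1), of 0 b x] b by (simp add: phi_power_def)
  then have "phi_power n x S = phi_power n (x - b) T" for x by simp
  with shift show "phi_orbit n T = phi_orbit n S" unfolding phi_orbit_def by blast
qed

lemma snake_composition_Cons:
  "snake_composition ((i, j) # q # ps) =
    (if q = (i, j + 2) then 2 else 1) # snake_composition (q # ps)"
  by (simp add: snake_composition_def)

lemma orbit_board_phi_power:
  assumes "n \<ge> 2" "S \<in> indep_sets n"
  shows "orbit_board n (\<lambda>r j. j \<in> phi_power n r S)"
proof
  show "0 \<notin> phi_power n r S" for r
    using phi_power_in_indep_sets[OF assms(2), of r] by (auto simp: indep_sets_def)
  show "Suc j \<in> phi_power n (r + 1) S \<longleftrightarrow>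
      Suc j \<le> n \<and> Suc j \<notin> phi_power n r S \<and> j \<notin> phi_power n (r + 1) S \<and>
      Suc (Suc j) \<notin> phi_power n r S" for r j
    unfolding phi_power_plus_1[OF assms(2)]
    by (rule mem_phi_iff[OF phi_power_in_indep_sets[OF assms(2)]])
qed (fact assms(1))

section \<open>The size of the orbit\<close>

theorem theorem4p12:
  fixes n :: nat and \<O> :: "nat set set" and c :: "nat list"
  assumes "n \<ge> 2"
    and "\<O> \<in> phi_orbits n"
    and "appears_in n c \<O>"
  shows "(\<not> periodic c \<longrightarrow> [int (card \<O>) = 1 - int n] (mod 4)) \<and>
    (\<exists>m::nat. m > 0 \<and> card \<O> dvd m \<and> [int m = 1 - int n] (mod 4) \<and> m \<le> 3 * (n - 1))"
proof -
  obtain S ps where S: "S \<in> \<O>" and ps: "is_snake n S ps" "c = snake_composition ps"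
    using assms(3) by (auto simp: appears_in_def)
  obtain S\<^sub>0 where S\<^sub>0: "S\<^sub>0 \<in> indep_sets n" "\<O> = phi_orbit n S\<^sub>0"
    using assms(2) by (auto simp: phi_orbits_def)
  \<comment> \<open>The orbit is based at \<open>S\<close>, so that the given snake lies on the
    board used below.\<close>
  have S_indep: "S \<in> indep_sets n" and \<O>: "\<O> = phi_orbit n S"
    using phi_orbit_eq[OF S\<^sub>0(1), of S] S S\<^sub>0(2) by simp_all
  define g where "g r = phi_power n r S" for r
  interpret orbit_board n "\<lambda>r j. j \<in> g r"
    unfolding g_def using assms(1) S_indep by (rule orbit_board_phi_power)
  have range: "range g = \<O>" by (simp add: \<O> phi_orbit_def g_def[abs_def])
  have fin: "finite (range g)"
    by (rule finite_subset[OF _ finite_indep_sets])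
      (use phi_power_in_indep_sets[OF S_indep] in \<open>auto simp: g_def\<close>)
  note period = range_period[OF phi_power_shift[OF S_indep S_indep, folded g_def] fin, unfolded range]

  have "ps \<noteq> []" "snd (last ps) = n" "\<forall>(i, j)\<in>set ps. j \<in> g i"
    "successively (\<lambda>(i, j) q. q = (i, j + 2) \<or> q = (i + 1, j + 1)) ps"
    using ps(1) by (auto simp: is_snake_def board_def g_def split: if_splits)
  then have "snake_from (fst (hd ps)) (snd (hd ps)) (snake_composition ps)"
  proof (induction ps rule: induct_list012)
    case (3 p q ps)
    then show ?case
      by (cases p; cases q) (auto simp: snake_composition_Cons)
  qed (auto simp: snake_composition_def)
  then obtain r where c: "snake_from r 1 c" using ps by (auto simp: is_snake_def)

  note sum = snake_from_sum[OF c] and len = snake_from_length[OF c]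
  define m where "m = 4 * length c - (n - 1)"
  have int_m: "int m = 4 * int (length c) - (int n - 1)" and m: "m > 0" "m \<le> 3 * (n - 1)"
    \<comment> \<open>The subtraction in \<open>m\<close> is not truncated:
      \<open>n - 1 = sum_list c \<le> 2 * length c\<close>.\<close>
    using sum len assms(1) by (auto simp: m_def of_nat_diff)
  have cong: "[int m = 1 - int n] (mod 4)" by (simp add: int_m cong_iff_dvd_diff)

  let ?a = "r + int n"
  \<comment> \<open>\<open>recurrence\<close> yields only inclusions. After \<open>card \<O>\<close>
    steps of \<open>m\<close> rows the same set returns, as \<open>card \<O>\<close> is a period, so
    all of them are equalities.\<close>
  have chain: "g x \<subseteq> g (x + int m * int k)" if "?a \<le> x" for x k
  proof (induction k)
    case (Suc k)
    have "g (x + int m * int k) \<subseteq> g (x + int m * int k + int m)"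
      using recurrence[OF c, of "x + int m * int k"] that
      by (auto simp: int_m[symmetric] add_increasing2)
    with Suc show ?case by (simp add: algebra_simps)
  qed simp
  have "g (?a + int m) \<subseteq> g (?a + int m + int m * int (card \<O> - 1))"
    by (rule chain) simp
  also have "?a + int m + int m * int (card \<O> - 1) = ?a + int m * int (card \<O>)"
    using period(1) by (simp add: of_nat_diff Suc_leI algebra_simps)
  also have "g (?a + int m * int (card \<O>)) = g ?a" using period(2) by simp
  finally have "g (?a + int m) = g ?a" using chain[of ?a 1] by auto
  then have dvd: "card \<O> dvd m" using period(2) by simp

  have "m dvd card \<O>" if "\<not> periodic c"
  proof -
    have g_shift: "g (x + int (card \<O>)) = g x" for x using period(2) by simp
    have "snake_from x j d \<longleftrightarrow> snake_from (x + int (card \<O>)) j d" for x j d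
    proof (induction d arbitrary: x j)
      case (Cons s d)
      have "x + int (card \<O>) + 1 = x + 1 + int (card \<O>)" by simp
      with Cons show ?case by (simp only: snake_from.simps g_shift flip: Cons)
    qed (simp add: g_shift)
    then have c': "snake_from (r + int (card \<O>)) 1 c" using c by blast
    obtain k where k: "snake_from (r + int (card \<O>)) 1 (rotate k c)" "int (card \<O>) = snake_offset c k"
      using all_starts[OF c snake_from_start[OF c']] by blast
    have "c \<noteq> []" using sum assms(1) by auto
    from rotate_eq_self_imp_periodic[OF this snake_from_unique[OF k(1) c']] that
    have "length c dvd k" by blast
    then obtain q where "k = q * length c" by (metis dvd_def mult.commute)
    then have "int (card \<O>) = int q * int m"
      using k(2) sum by (simp add: snake_offset_mult snake_offset_length int_m)
    then show ?thesis by (metis dvd_triv_right of_nat_eq_iff of_nat_mult)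
  qed
  then have "card \<O> = m" if "\<not> periodic c" using that dvd dvd_antisym by blast
  then show ?thesis using cong dvd m by auto
qed

end
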